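(* Let $m_1,m_2\ge1$ and $m_1+m_2\le d$, and let $A_1\in\mathbb R^{m_1\times d}$ and $A_2\in\mathbb R^{m_2\times d}$ have i.i.d. standard normal entries (all entries of both matrices jointly independent). Then, with probability one, for every $b_1\in\mathbb R^{m_1}$ and $b_2\in\mathbb R^{m_2}$, the set of common interpolators $\{\bar x\in\mathbb R^d: A_1\bar x=b_1,\ A_2\bar x=b_2\}$ is a nonempty affine subspace of dimension $d-m_1-m_2$, and every one of its points is an inactive global minimizer of $$f_{\mathrm{2G}}(x)=\max_{s\in\{1,2\}}\frac1{2m_s}\|A_sx-b_s\|^2.$$
   Context: $\partial$ denotes the limiting subdifferential. For a locally Lipschitz $h:\mathbb R^d\to\mathbb R$ and $\bar v\in\partial h(\bar x)$, a set $\mathcal M\ni\bar x$ is identifiable for $h$ at $\bar x$ for $\bar v$ if for all sequences $x_\nu\to\bar x$, $v_\nu\to\bar v$ with $v_\nu\in\partial h(x_\nu)$ one has $x_\nu\in\mathcal M$ for all large $\nu$. It is a $C^2$ identifiable manifold if it is identifiable and, in a neighborhood of $\bar x$, is a $C^2$ embedded submanifold of $\mathbb R^d$ on which $h$ restricts to a $C^2$ function. A point $\bar x$ with $0\in\partial h(\bar x)$ is inactive if no $C^2$ identifiable manifold exists for $h$ at $\bar x$ for $0$. *)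

theory Defs
  imports "HOL-Probability.Probability"
begin

text \<open>
  The regular (Frechet) subgradients \<open>v\<close> of \<open>h\<close> at \<open>x\<close>:
  \<open>h y \<ge> h x + v \<bullet> (y - x) + o(norm (y - x))\<close> as \<open>y\<close> tends to \<open>x\<close>.
\<close>

definition regular_subdiff :: "('a::euclidean_space \<Rightarrow> real) \<Rightarrow> 'a \<Rightarrow> 'a set" where
  "regular_subdiff h x =
     {v. \<forall>e>0. \<forall>\<^sub>F y in at x. h y \<ge> h x + v \<bullet> (y - x) - e * norm (y - x)}"

text \<open>
  The attentiveness condition \<open>h (xs n) \<longlonglongrightarrow> h x\<close> is automatic for the locally Lipschitz
  functions of interest. The notions below are stated for arbitrary \<open>h\<close>.
\<close>

definition limiting_subdiff :: "('a::euclidean_space \<Rightarrow> real) \<Rightarrow> 'a \<Rightarrow> 'a set" where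
  "limiting_subdiff h x =
     {v. \<exists>xs vs. xs \<longlonglongrightarrow> x \<and> (\<lambda>n. h (xs n)) \<longlonglongrightarrow> h x \<and> vs \<longlonglongrightarrow> v \<and>
        (\<forall>n. vs n \<in> regular_subdiff h (xs n))}"

definition identifiable :: "('a::euclidean_space \<Rightarrow> real) \<Rightarrow> 'a \<Rightarrow> 'a \<Rightarrow> 'a set \<Rightarrow> bool" where
  "identifiable h x v S \<longleftrightarrow>
     v \<in> limiting_subdiff h x \<and> x \<in> S \<and>
     (\<forall>xs vs. xs \<longlonglongrightarrow> x \<longrightarrow> vs \<longlonglongrightarrow> v \<longrightarrow> (\<forall>n. vs n \<in> limiting_subdiff h (xs n)) \<longrightarrow>
        (\<forall>\<^sub>F n in sequentially. xs n \<in> S))"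

definition C2_on :: "('a::real_normed_vector \<Rightarrow> 'b::real_normed_vector) \<Rightarrow> 'a set \<Rightarrow> bool" where
  "C2_on f U \<longleftrightarrow> open U \<and>
     (\<exists>(f' :: 'a \<Rightarrow> 'a \<Rightarrow>\<^sub>L 'b) (f'' :: 'a \<Rightarrow> 'a \<Rightarrow>\<^sub>L 'a \<Rightarrow>\<^sub>L 'b).
        (\<forall>x\<in>U. (f has_derivative blinfun_apply (f' x)) (at x)) \<and>
        (\<forall>x\<in>U. (f' has_derivative blinfun_apply (f'' x)) (at x)) \<and>
        continuous_on U f'')"

text \<open>
  Embedded submanifolds are described by slice charts: near each of its points, \<open>S\<close> is
  straightened to a \<open>k\<close>-dimensional linear subspace by a \<open>C\<^sup>2\<close> diffeomorphism of open subsets of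
  the ambient space.
\<close>

definition C2_submanifold :: "nat \<Rightarrow> 'a::euclidean_space set \<Rightarrow> bool" where
  "C2_submanifold k S \<longleftrightarrow>
     (\<forall>p\<in>S. \<exists>U V (\<phi> :: 'a \<Rightarrow> 'a) \<psi> L.
        p \<in> U \<and> homeomorphism U V \<phi> \<psi> \<and> C2_on \<phi> U \<and> C2_on \<psi> V \<and>
        subspace L \<and> dim L = k \<and> \<phi> ` (S \<inter> U) = V \<inter> L)"

text \<open>
  A function on an embedded submanifold is \<open>C\<^sup>2\<close> if it locally extends to a \<open>C\<^sup>2\<close> function on
  the ambient space.
\<close>

definition C2_on_submanifold :: "('a::euclidean_space \<Rightarrow> real) \<Rightarrow> 'a set \<Rightarrow> bool" where
  "C2_on_submanifold h S \<longleftrightarrow>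
     (\<forall>p\<in>S. \<exists>U g. p \<in> U \<and> C2_on g U \<and> (\<forall>y\<in>S \<inter> U. g y = h y))"

definition C2_identifiable_manifold ::
    "('a::euclidean_space \<Rightarrow> real) \<Rightarrow> 'a \<Rightarrow> 'a \<Rightarrow> 'a set \<Rightarrow> bool" where
  "C2_identifiable_manifold h x v S \<longleftrightarrow>
     identifiable h x v S \<and>
     (\<exists>W k. open W \<and> x \<in> W \<and> C2_submanifold k (S \<inter> W) \<and> C2_on_submanifold h (S \<inter> W))"

definition inactive :: "('a::euclidean_space \<Rightarrow> real) \<Rightarrow> 'a \<Rightarrow> bool" where
  "inactive h x \<longleftrightarrow>
     0 \<in> limiting_subdiff h x \<and> \<not> (\<exists>S. C2_identifiable_manifold h x 0 S)"

definition f2G ::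
    "real^'d^'m1 \<Rightarrow> real^'d^'m2 \<Rightarrow> real^'m1 \<Rightarrow> real^'m2 \<Rightarrow> real^'d \<Rightarrow> real" where
  "f2G A1 A2 b1 b2 x =
     max (1 / (2 * real CARD('m1)) * (norm (A1 *v x - b1))\<^sup>2)
         (1 / (2 * real CARD('m2)) * (norm (A2 *v x - b2))\<^sup>2)"

definition common_interpolators ::
    "real^'d^'m1 \<Rightarrow> real^'d^'m2 \<Rightarrow> real^'m1 \<Rightarrow> real^'m2 \<Rightarrow> (real^'d) set" where
  "common_interpolators A1 A2 b1 b2 = {x. A1 *v x = b1 \<and> A2 *v x = b2}"

end

theory Submission imports Defs begin

text \<open>
  Write \<open>T x = (A1 *v x, A2 *v x)\<close>. The randomness only serves to make \<open>T\<close> surjective: since the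
  total number of rows is at most the number of columns, one may choose a square submatrix of the
  stacked matrix with as many columns as there are rows. Its determinant is a nonzero polynomial,
  affine in each of the independent entries, and the zeros of such a polynomial are null for every
  product of atomless laws (\<open>AE_multiaffine_nonzero\<close>). Surjectivity of \<open>T\<close> does not involve the
  right-hand sides, so one null set serves all \<open>b1\<close> and \<open>b2\<close> at once.

  The remaining argument is deterministic. The interpolators form a translate of the kernel of
  \<open>T\<close>, whose dimension follows from rank-nullity. At an interpolator \<open>x\<close> both squared residuals
  attain their minimum \<open>0\<close>, so \<open>x\<close> minimizes \<open>f2G\<close> and both gradients vanish there. As a gradient
  of the larger residual is a subgradient of the maximum, every point near \<open>x\<close> carries a
  subgradient near \<open>0\<close>. An identifiable set for the subgradient \<open>0\<close> must therefore contain a full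
  neighbourhood of \<open>x\<close> (\<open>identifiable_contains_neighbourhood\<close>), and a \<open>C\<^sup>2\<close> identifiable manifold
  would force \<open>f2G\<close> to be differentiable near \<open>x\<close>. This fails: surjectivity of \<open>T\<close> provides two
  directions, each of which moves only one of the residuals, and in these directions \<open>f2G\<close> has the
  form \<open>max (s\<^sup>2) (t\<^sup>2)\<close>, which has a kink at every point of the diagonal other than the origin
  (\<open>f2G_not_differentiable_near_interpolator\<close>).
\<close>

section \<open>Generic full rank of a matrix with independent atomless entries\<close>

text \<open>
  Induction on the variables: the polynomial has the form \<open>H x + y * G x\<close> in a new variable \<open>y\<close>.
  If \<open>G\<close> has a nonzero coefficient, it is almost surely nonzero by induction, and then a single
  value of \<open>y\<close> is excluded. Otherwise \<open>G\<close> vanishes identically and \<open>H\<close> has a nonzero coefficient.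
  Fubini turns either case into the claim.
\<close>

lemma AE_multiaffine_nonzero:
  fixes N :: "'i \<Rightarrow> real measure" and c :: "'i set \<Rightarrow> real"
  assumes "finite E"
    and prob: "\<And>i. prob_space (N i)"
    and sets_N: "\<And>i. sets (N i) = sets borel"
    and atomless: "\<And>i a. AE y in N i. y \<noteq> a"
    and "\<exists>K\<subseteq>E. c K \<noteq> 0"
  shows "AE x in PiM E N. (\<Sum>K\<in>Pow E. c K * (\<Prod>e\<in>K. x e)) \<noteq> 0"
  using \<open>finite E\<close> \<open>\<exists>K\<subseteq>E. c K \<noteq> 0\<close>
proof (induction E arbitrary: c rule: finite_induct)
  case empty
  then show ?case by simp
next
  case (insert i E)
  interpret product_prob_space N by (rule product_prob_spaceI) (rule prob)
  have [measurable_cong]: "sets (N j) = sets borel" for j by (rule sets_N)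
  define G where "G x = (\<Sum>K\<in>Pow E. c (insert i K) * (\<Prod>e\<in>K. x e))" for x :: "'i \<Rightarrow> real"
  define H where "H x = (\<Sum>K\<in>Pow E. c K * (\<Prod>e\<in>K. x e))" for x :: "'i \<Rightarrow> real"
  let ?F = "\<lambda>x :: 'i \<Rightarrow> real. \<Sum>K\<in>Pow (insert i E). c K * (\<Prod>e\<in>K. x e)"
  have split: "?F (x(i := y)) = H x + y * G x" for x y
  proof -
    have notin: "i \<notin> K" "finite K" if "K \<in> Pow E" for K
      using that insert.hyps by (auto intro: finite_subset)
    have "?F (x(i := y)) = (\<Sum>K\<in>Pow E. c K * (\<Prod>e\<in>K. (x(i := y)) e))
        + (\<Sum>K\<in>insert i ` Pow E. c K * (\<Prod>e\<in>K. (x(i := y)) e))"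
      unfolding Pow_insert using insert.hyps by (intro sum.union_disjoint) auto
    also have "(\<Sum>K\<in>Pow E. c K * (\<Prod>e\<in>K. (x(i := y)) e)) = H x"
      unfolding H_def using notin by (intro sum.cong refl arg_cong2[where f="(*)"] prod.cong) auto
    also have "(\<Sum>K\<in>insert i ` Pow E. c K * (\<Prod>e\<in>K. (x(i := y)) e))
        = (\<Sum>K\<in>Pow E. c (insert i K) * (\<Prod>e\<in>insert i K. (x(i := y)) e))"
      using insert.hyps by (subst sum.reindex) (auto simp: inj_on_def)
    also have "\<dots> = (\<Sum>K\<in>Pow E. c (insert i K) * (y * (\<Prod>e\<in>K. x e)))"
    proof (intro sum.cong refl arg_cong2[where f="(*)"])
      fix K assume "K \<in> Pow E"
      note nK = notin[OF this]
      have "(\<Prod>e\<in>K. (x(i := y)) e) = (\<Prod>e\<in>K. x e)"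
        using nK by (intro prod.cong) auto
      then show "(\<Prod>e\<in>insert i K. (x(i := y)) e) = y * (\<Prod>e\<in>K. x e)"
        using nK by (simp add: prod.insert)
    qed
    also have "\<dots> = y * G x"
      unfolding G_def sum_distrib_left by (intro sum.cong) (auto simp: algebra_simps)
    finally show ?thesis .
  qed
  have fibre: "AE x in PiM E N. AE y in N i. ?F (x(i := y)) \<noteq> 0"
  proof (cases "\<exists>K\<subseteq>E. c (insert i K) \<noteq> 0")
    case True
    from insert.IH[OF True] have "AE x in PiM E N. G x \<noteq> 0"
      unfolding G_def .
    then show ?thesis
    proof eventually_elim
      case (elim x)
      \<comment> \<open>for a nonzero leading coefficient the single bad value is the root \<open>- H x / G x\<close>\<close>
      from atomless[where a="- H x / G x"] show ?case
        unfolding split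
        by eventually_elim (use elim in \<open>simp only: eq_divide_eq add_eq_0_iff if_True simp_thms\<close>)
    qed
  next
    case False
    then have "G = (\<lambda>x. 0)" unfolding G_def by (intro ext sum.neutral) auto
    moreover have "\<exists>K\<subseteq>E. c K \<noteq> 0"
    proof -
      obtain K where K: "K \<subseteq> insert i E" "c K \<noteq> 0" using insert.prems by blast
      have "i \<notin> K"
      proof
        assume "i \<in> K"
        then have "insert i (K - {i}) = K" "K - {i} \<subseteq> E" using K by auto
        then show False using False K by metis
      qed
      then show ?thesis using K by blast
    qed
    from insert.IH[OF this] have "AE x in PiM E N. H x \<noteq> 0"
      unfolding H_def .
    ultimately show ?thesis
      unfolding split by (auto elim: eventually_mono)
  qed
  have meas: "?F \<in> borel_measurable (PiM (insert i E) N)"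
  proof (intro borel_measurable_sum borel_measurable_times borel_measurable_const borel_measurable_prod)
    fix K e assume "K \<in> Pow (insert i E)" "e \<in> K"
    then have "e \<in> insert i E" by auto
    then show "(\<lambda>x. x e) \<in> borel_measurable (PiM (insert i E) N)"
      using measurable_component_singleton[of e "insert i E" N]
      by (simp add: measurable_cong_sets[OF refl sets_N])
  qed
  let ?Z = "{x \<in> space (PiM (insert i E) N). ?F x = 0}"
  have Z [measurable]: "?Z \<in> sets (PiM (insert i E) N)"
    using meas by measurable
  have "emeasure (PiM (insert i E) N) ?Z = (\<integral>\<^sup>+ x. indicator ?Z x \<partial>PiM (insert i E) N)"
    by simp
  also have "\<dots> = (\<integral>\<^sup>+ x. (\<integral>\<^sup>+ y. indicator ?Z (x(i := y)) \<partial>N i) \<partial>PiM E N)"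
    using insert.hyps by (intro product_nn_integral_insert) auto
  also have "\<dots> = (\<integral>\<^sup>+ x. 0 \<partial>PiM E N)"
  proof (rule nn_integral_cong_AE, use fibre in eventually_elim)
    case (elim x)
    have "(\<integral>\<^sup>+ y. indicator ?Z (x(i := y)) \<partial>N i) = (\<integral>\<^sup>+ y. 0 \<partial>N i)"
      by (rule nn_integral_cong_AE, use elim in eventually_elim) (auto simp: indicator_def)
    then show ?case by simp
  qed
  finally have "emeasure (PiM (insert i E) N) ?Z = 0" by simp
  then show ?case
    using Z by (intro AE_I[where N="?Z"]) auto
qed

text \<open>
  The Leibniz formula is multiaffine in the entries. Distinct permutations have distinct graphs, so
  no terms cancel, and the product over the diagonal has coefficient \<open>1\<close>. The map \<open>e\<close> places the
  matrix inside a larger family of variables.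
\<close>

lemma AE_det_nonzero:
  fixes N :: "'i::finite \<Rightarrow> real measure" and e :: "'n::finite \<times> 'n \<Rightarrow> 'i"
  assumes prob: "\<And>i. prob_space (N i)"
    and sets_N: "\<And>i. sets (N i) = sets borel"
    and atomless: "\<And>i a. AE y in N i. y \<noteq> a"
    and "inj e"
  shows "AE x in PiM UNIV N. det (\<chi> r k. x (e (r, k)) :: real^'n^'n) \<noteq> 0"
proof -
  let ?P = "{p :: 'n \<Rightarrow> 'n. p permutes UNIV}"
  let ?g = "\<lambda>p. range (\<lambda>r. e (r, p r))"
  define c where "c K = (\<Sum>p\<in>{p \<in> ?P. ?g p = K}. of_int (sign p) :: real)" for K
  have "p = id" if "?g p = ?g id" for p
  proof
    fix r
    have "e (r, p r) \<in> ?g id" using that by blast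
    then show "p r = id r" using \<open>inj e\<close> by (auto simp: inj_def)
  qed
  then have "{p \<in> ?P. ?g p = ?g id} = {id}"
    by (auto simp: permutes_id)
  then have "c (?g id) = 1"
    unfolding c_def by simp
  then have "\<exists>K\<subseteq>UNIV. c K \<noteq> 0"
    by (intro exI[of _ "?g id"]) auto
  note AE = AE_multiaffine_nonzero[OF finite prob sets_N atomless this]
  have "det (\<chi> r k. x (e (r, k)) :: real^'n^'n) = (\<Sum>K\<in>Pow UNIV. c K * (\<Prod>i\<in>K. x i))" for x
  proof -
    have "det (\<chi> r k. x (e (r, k)) :: real^'n^'n)
        = (\<Sum>p\<in>?P. of_int (sign p) * (\<Prod>i\<in>?g p. x i))"
      unfolding det_def
    proof (intro sum.cong refl arg_cong2[where f="(*)"])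
      fix p
      have "inj (\<lambda>r. e (r, p r))"
        using \<open>inj e\<close> by (auto simp: inj_def)
      then show "(\<Prod>i\<in>UNIV. (\<chi> r k. x (e (r, k)) :: real^'n^'n) $ i $ p i) = (\<Prod>i\<in>?g p. x i)"
        by (subst prod.reindex) auto
    qed
    also have "\<dots> = (\<Sum>K\<in>Pow UNIV. \<Sum>p\<in>{p \<in> ?P. ?g p = K}. of_int (sign p) * (\<Prod>i\<in>?g p. x i))"
      by (rule sum.group[symmetric]) auto
    also have "\<dots> = (\<Sum>K\<in>Pow UNIV. c K * (\<Prod>i\<in>K. x i))"
      unfolding c_def sum_distrib_right by (intro sum.cong refl) auto
    finally show ?thesis .
  qed
  with AE show ?thesis by simp
qed

lemma AE_std_normal_neq:
  assumes "distributed M lborel X std_normal_density"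
  shows "AE y in distr M borel X. y \<noteq> a"
proof -
  have "distr M borel X = distr M lborel X"
    by (rule distr_cong) auto
  also have "\<dots> = density lborel std_normal_density"
    using assms by (rule distributed_distr_eq_density)
  finally have law: "distr M borel X = density lborel std_normal_density" .
  have "AE y in lborel. 0 < ennreal (std_normal_density y) \<longrightarrow> y \<noteq> a"
    using AE_lborel_singleton[of a] by eventually_elim auto
  then show ?thesis
    unfolding law by (subst AE_density) simp_all
qed

text \<open>
  Solve the square system for the coordinates selected by \<open>\<sigma>\<close> and set all others to zero.
\<close>

lemma stacked_surjective_if_minor_nonsingular:
  fixes A1 :: "real^'d^'m1" and A2 :: "real^'d^'m2" and \<sigma> :: "'m1 + 'm2 \<Rightarrow> 'd"
  assumes "inj \<sigma>"
    and "det (\<chi> r k. (case r of Inl i \<Rightarrow> A1 $ i $ \<sigma> k | Inr i \<Rightarrow> A2 $ i $ \<sigma> k)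
           :: real^('m1 + 'm2)^('m1 + 'm2)) \<noteq> 0" (is "det ?B \<noteq> 0")
  shows "\<exists>x. A1 *v x = b1 \<and> A2 *v x = b2"
proof -
  define b :: "real^('m1 + 'm2)" where "b = (\<chi> r. case r of Inl i \<Rightarrow> b1 $ i | Inr i \<Rightarrow> b2 $ i)"
  have "invertible ?B" using assms(2) by (simp only: invertible_det_nz not_False_eq_True)
  then obtain B' where B': "?B ** B' = mat 1" unfolding invertible_def by blast
  define z where "z = B' *v b"
  have z: "?B *v z = b"
    unfolding z_def matrix_vector_mul_assoc B' by (rule matrix_vector_mul_lid)
  define x :: "real^'d" where "x = (\<chi> j. if j \<in> range \<sigma> then z $ inv \<sigma> j else 0)"
  have sum_x: "(\<Sum>j\<in>UNIV. w j * x $ j) = (\<Sum>k\<in>UNIV. w (\<sigma> k) * z $ k)" for w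
  proof -
    have "(\<Sum>j\<in>UNIV. w j * x $ j) = (\<Sum>j\<in>range \<sigma>. w j * x $ j)"
      by (rule sum.mono_neutral_right) (auto simp: x_def)
    also have "\<dots> = (\<Sum>k\<in>UNIV. w (\<sigma> k) * z $ k)"
      using \<open>inj \<sigma>\<close> by (subst sum.reindex) (auto simp: x_def)
    finally show ?thesis .
  qed
  have "A1 *v x = b1"
  proof (rule vec_eq_iff[THEN iffD2], rule allI)
    fix i
    show "(A1 *v x) $ i = b1 $ i"
      using arg_cong[OF z, of "\<lambda>v. v $ Inl i"]
      by (simp add: matrix_vector_mult_def sum_x b_def)
  qed
  moreover have "A2 *v x = b2"
  proof (rule vec_eq_iff[THEN iffD2], rule allI)
    fix i
    show "(A2 *v x) $ i = b2 $ i"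
      using arg_cong[OF z, of "\<lambda>v. v $ Inr i"]
      by (simp add: matrix_vector_mult_def sum_x b_def)
  qed
  ultimately show ?thesis by blast
qed

lemma AE_stacked_surjective:
  fixes M :: "'w measure"
    and A1 :: "'w \<Rightarrow> real^'d::finite^'m1::finite"
    and A2 :: "'w \<Rightarrow> real^'d::finite^'m2::finite"
  assumes "prob_space M"
    and "CARD('m1) + CARD('m2) \<le> CARD('d)"
    and indep: "prob_space.indep_vars M (\<lambda>_. borel)
           (\<lambda>e \<omega>. case e of Inl (i, j) \<Rightarrow> A1 \<omega> $ i $ j | Inr (i, j) \<Rightarrow> A2 \<omega> $ i $ j)
           (UNIV :: ('m1 \<times> 'd + 'm2 \<times> 'd) set)"
    and D1: "\<And>i j. distributed M lborel (\<lambda>\<omega>. A1 \<omega> $ i $ j) std_normal_density"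
    and D2: "\<And>i j. distributed M lborel (\<lambda>\<omega>. A2 \<omega> $ i $ j) std_normal_density"
  shows "AE \<omega> in M. \<forall>b1 b2. \<exists>x. A1 \<omega> *v x = b1 \<and> A2 \<omega> *v x = b2"
proof -
  interpret prob_space M by fact
  define X where "X e \<omega> = (case e of Inl (i, j) \<Rightarrow> A1 \<omega> $ i $ j | Inr (i, j) \<Rightarrow> A2 \<omega> $ i $ j)"
    for e :: "'m1 \<times> 'd + 'm2 \<times> 'd" and \<omega>
  have indep_X: "indep_vars (\<lambda>_. borel) X UNIV"
    using indep unfolding X_def .
  then have [measurable]: "X e \<in> borel_measurable M" for e
    unfolding indep_vars_def by auto
  have law: "distr M (PiM UNIV (\<lambda>_. borel)) (\<lambda>\<omega>. \<lambda>e\<in>UNIV. X e \<omega>) = PiM UNIV (\<lambda>e. distr M borel (X e))"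
    using indep_X by (subst (asm) indep_vars_iff_distr_eq_PiM) auto
  have D: "distributed M lborel (X e) std_normal_density" for e
    unfolding X_def using D1 D2 by (cases e) (auto split: prod.splits)
  obtain \<sigma> :: "'m1 + 'm2 \<Rightarrow> 'd" where "inj \<sigma>"
    using card_le_inj[of "UNIV :: ('m1 + 'm2) set" "UNIV :: 'd set"] assms(2)
    by (auto simp: UNIV_Plus_UNIV[symmetric] card_Plus simp del: UNIV_Plus_UNIV)
  define pos :: "('m1 + 'm2) \<times> ('m1 + 'm2) \<Rightarrow> 'm1 \<times> 'd + 'm2 \<times> 'd"
    where "pos = (\<lambda>(r, k). case r of Inl i \<Rightarrow> Inl (i, \<sigma> k) | Inr i \<Rightarrow> Inr (i, \<sigma> k))"
  have "inj pos"
    using \<open>inj \<sigma>\<close> by (auto simp: inj_def pos_def split: sum.splits)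
  have "AE x in PiM UNIV (\<lambda>e. distr M borel (X e)). det (\<chi> r k. x (pos (r, k)) :: real^('m1+'m2)^('m1+'m2)) \<noteq> 0"
    by (rule AE_det_nonzero) (auto intro!: prob_space_distr AE_std_normal_neq D \<open>inj pos\<close>)
  then have "AE x in distr M (PiM UNIV (\<lambda>_. borel)) (\<lambda>\<omega>. \<lambda>e\<in>UNIV. X e \<omega>).
      det (\<chi> r k. x (pos (r, k)) :: real^('m1+'m2)^('m1+'m2)) \<noteq> 0"
    unfolding law .
  then have "AE \<omega> in M. det (\<chi> r k. X (pos (r, k)) \<omega> :: real^('m1+'m2)^('m1+'m2)) \<noteq> 0"
    by (drule_tac AE_distrD[rotated]) auto
  then show ?thesis
  proof eventually_elim
    case (elim \<omega>)
    have "(\<chi> r k. X (pos (r, k)) \<omega>) = (\<chi> r k. (case r of Inl i \<Rightarrow> A1 \<omega> $ i $ \<sigma> k | Inr i \<Rightarrow> A2 \<omega> $ i $ \<sigma> k)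
           :: real^('m1 + 'm2)^('m1 + 'm2))"
      by (auto simp: vec_eq_iff X_def pos_def split: sum.splits)
    with elim show ?case
      using stacked_surjective_if_minor_nonsingular[OF \<open>inj \<sigma>\<close>] by auto
  qed
qed


section \<open>The set of common interpolators\<close>

text \<open>
  The kernel is the orthogonal complement of the range of the adjoint, and the adjoint of a
  surjective map is injective.
\<close>

lemma dim_kernel_of_surjective:
  fixes T :: "'a::euclidean_space \<Rightarrow> 'b::euclidean_space"
  assumes "linear T" "surj T"
  shows "dim {x. T x = 0} + DIM('b) = DIM('a)"
proof -
  have lin: "linear (adjoint T)" using assms(1) by (rule adjoint_linear)
  have adj: "adjoint T u \<bullet> x = u \<bullet> T x" for u x
    using adjoint_works[OF assms(1)] by (simp add: inner_commute)
  have inj: "inj (adjoint T)"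
  proof (rule linear_injective_0[OF lin, THEN iffD2], intro allI impI)
    fix u assume "adjoint T u = 0"
    then have "u \<bullet> T x = 0" for x using adj[of u x] by simp
    moreover obtain x where "T x = u" using assms(2) by (metis surjD)
    ultimately show "u = 0" by (metis inner_eq_zero_iff)
  qed
  have "{x. T x = 0} = {y \<in> UNIV. \<forall>x\<in>range (adjoint T). orthogonal x y}"
    using adj by (auto simp: orthogonal_def) (metis inner_eq_zero_iff)
  moreover have "dim (range (adjoint T)) = DIM('b)"
    using dim_image_eq[OF lin, of UNIV] inj by simp
  ultimately show ?thesis
    using dim_subspace_orthogonal_to_vectors[of "range (adjoint T)" UNIV]
      linear_subspace_image[OF lin subspace_UNIV] by simp
qed

lemma common_interpolators_affine:
  fixes A1 :: "real^'d^'m1" and A2 :: "real^'d^'m2"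
  assumes surj: "\<forall>b1 b2. \<exists>x. A1 *v x = b1 \<and> A2 *v x = b2"
  shows "common_interpolators A1 A2 b1 b2 \<noteq> {}"
    and "affine (common_interpolators A1 A2 b1 b2)"
    and "aff_dim (common_interpolators A1 A2 b1 b2)
           = int CARD('d) - int CARD('m1) - int CARD('m2)"
proof -
  obtain x0 where x0: "A1 *v x0 = b1" "A2 *v x0 = b2" using surj by blast
  let ?T = "\<lambda>x. (A1 *v x, A2 *v x)"
  have lin: "linear ?T"
    by (intro linearI) (simp_all add: matrix_vector_right_distrib matrix_vector_mult_scaleR)
  have "surj ?T" unfolding surj_def
  proof
    fix b :: "(real^'m1) \<times> (real^'m2)"
    show "\<exists>x. b = ?T x" using surj by (metis surjective_pairing)
  qed
  have ker: "subspace {x. ?T x = 0}"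
    using lin by (rule linear_subspace_kernel)
  have eq: "common_interpolators A1 A2 b1 b2 = (+) x0 ` {x. ?T x = 0}"
  proof (intro set_eqI iffI)
    fix x assume "x \<in> common_interpolators A1 A2 b1 b2"
    then have "?T (x - x0) = 0"
      using x0 by (simp add: common_interpolators_def matrix_vector_mult_diff_distrib zero_prod_def)
    then show "x \<in> (+) x0 ` {x. ?T x = 0}" by (intro image_eqI[of _ _ "x - x0"]) auto
  qed (use x0 in \<open>auto simp: common_interpolators_def matrix_vector_right_distrib zero_prod_def\<close>)
  show "common_interpolators A1 A2 b1 b2 \<noteq> {}"
    using x0 by (auto simp: common_interpolators_def)
  show "affine (common_interpolators A1 A2 b1 b2)"
    unfolding eq using subspace_imp_affine[OF ker] affine_translation by blast
  show "aff_dim (common_interpolators A1 A2 b1 b2)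
           = int CARD('d) - int CARD('m1) - int CARD('m2)"
    unfolding eq aff_dim_translation_eq aff_dim_subspace[OF ker]
    using dim_kernel_of_surjective[OF lin \<open>surj ?T\<close>] by simp
qed


section \<open>Identifiable sets at points with small nearby subgradients\<close>

lemma limiting_subdiffI_affine_minorant:
  assumes "\<And>y. h y \<ge> h x + v \<bullet> (y - x)"
  shows "v \<in> limiting_subdiff h x"
proof -
  have "h y \<ge> h x + v \<bullet> (y - x) - e * norm (y - x)" if "e > 0" for e y
    using assms[of y] mult_nonneg_nonneg[of e "norm (y - x)"] that
      norm_ge_zero[of "y - x"] by linarith
  then have "v \<in> regular_subdiff h x"
    unfolding regular_subdiff_def by (auto intro: always_eventually)
  then show ?thesis
    unfolding limiting_subdiff_def
    by (intro CollectI exI[of _ "\<lambda>_. x"] exI[of _ "\<lambda>_. v"]) simp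
qed

text \<open>
  If \<open>S\<close> missed points arbitrarily close to \<open>x\<close>, then a sequence of such points together with the
  subgradients \<open>G\<close> selects there would contradict identifiability. So a selection
  continuous at \<open>x\<close> leaves no room for lower-dimensional identifiable sets.
\<close>

lemma identifiable_contains_neighbourhood:
  assumes ident: "identifiable h x v S"
    and G: "\<And>y. G y \<in> limiting_subdiff h y" "isCont G x" "G x = v"
  shows "x \<in> interior S"
proof (rule ccontr)
  assume not: "x \<notin> interior S"
  have "\<exists>y. y \<in> ball x (inverse (real (Suc n))) \<and> y \<notin> S" for n
    using not by (auto simp: mem_interior subset_eq dest!: spec[of _ "inverse (real (Suc n))"])
  then obtain xs where xs: "\<And>n. xs n \<in> ball x (inverse (real (Suc n)))" "\<And>n. xs n \<notin> S"
    by metis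
  have lim: "xs \<longlonglongrightarrow> x"
  proof (rule Lim_null_comparison[THEN LIM_zero_cancel])
    show "\<forall>\<^sub>F n in sequentially. norm (xs n - x) \<le> inverse (real (Suc n))"
      using xs(1) by (intro always_eventually allI less_imp_le)
        (simp add: dist_norm norm_minus_commute)
    show "(\<lambda>n. inverse (real (Suc n))) \<longlonglongrightarrow> 0" by (rule LIMSEQ_inverse_real_of_nat)
  qed
  moreover have "(\<lambda>n. G (xs n)) \<longlonglongrightarrow> v"
    using isCont_tendsto_compose[OF G(2) lim] G(3) by simp
  ultimately have "\<forall>\<^sub>F n in sequentially. xs n \<in> S"
    using ident G(1) unfolding identifiable_def
    by (elim conjE allE[of _ xs] allE[of _ "\<lambda>n. G (xs n)"]) auto
  then show False using xs(2) by simp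
qed

text \<open>
  On a manifold of full dimension the local \<open>C\<^sup>2\<close> extension of \<open>h\<close> coincides with \<open>h\<close> on an open
  set, so the smoothness of \<open>h\<close> along the manifold becomes ordinary smoothness.
\<close>

lemma C2_identifiable_manifold_interior_differentiable:
  assumes "C2_identifiable_manifold h x v S" "x \<in> interior S"
  shows "\<forall>\<^sub>F y in nhds x. h differentiable (at y)"
proof -
  obtain W where W: "open W" "x \<in> W" "C2_on_submanifold h (S \<inter> W)"
    using assms(1) unfolding C2_identifiable_manifold_def by blast
  have "x \<in> S \<inter> W" using W assms(2) interior_subset by blast
  then obtain U g where U: "x \<in> U" "C2_on g U" "\<forall>y\<in>S \<inter> W \<inter> U. g y = h y"
    using W(3) unfolding C2_on_submanifold_def by blast
  let ?O = "interior S \<inter> W \<inter> U"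
  have "open U" using U(2) unfolding C2_on_def by blast
  then have "open ?O" "x \<in> ?O" using W U assms(2) by auto
  have "h differentiable (at y)" if y: "y \<in> ?O" for y
  proof -
    obtain g' where "(g has_derivative g') (at y)"
      using U(2) y unfolding C2_on_def by blast
    moreover have "g z = h z" if "z \<in> ?O" for z
      using U(3) that interior_subset by blast
    ultimately have "(h has_derivative g') (at y)"
      using has_derivative_transform_within_open[OF _ \<open>open ?O\<close> y] by blast
    then show ?thesis by (auto simp: differentiable_def)
  qed
  then show ?thesis
    using \<open>open ?O\<close> \<open>x \<in> ?O\<close> eventually_nhds by blast
qed


section \<open>The maximum of two squared residuals\<close>

text \<open>
  The gap between the two sides is \<open>c * (norm (A *v (z - y)))\<^sup>2\<close>.
\<close>

lemma squared_residual_affine_minorant: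
  fixes A :: "real^'d^'m"
  assumes "c \<ge> 0"
  shows "c * (norm (A *v z - b))\<^sup>2 \<ge> c * (norm (A *v y - b))\<^sup>2
           + ((2 * c) *\<^sub>R (transpose A *v (A *v y - b))) \<bullet> (z - y)"
proof -
  define r e where "r = A *v y - b" and "e = A *v (z - y)"
  have "A *v z - b = r + e"
    by (simp add: r_def e_def matrix_vector_mult_diff_distrib)
  then have "(norm (A *v z - b))\<^sup>2 = (norm r)\<^sup>2 + 2 * (r \<bullet> e) + (norm e)\<^sup>2"
    by (simp add: power2_norm_eq_inner inner_add_left inner_add_right inner_commute)
  then have "c * (norm (A *v z - b))\<^sup>2 = c * (norm r)\<^sup>2 + 2 * c * (r \<bullet> e) + c * (norm e)\<^sup>2"
    by (simp add: algebra_simps)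
  moreover have "(transpose A *v r) \<bullet> (z - y) = r \<bullet> e"
    unfolding e_def by (metis dot_lmul_matrix vector_transpose_matrix transpose_transpose)
  moreover have "c * (norm e)\<^sup>2 \<ge> 0" using assms by simp
  ultimately show ?thesis by (simp add: r_def)
qed

text \<open>
  Take the gradient of whichever residual term is larger. This selection jumps where the two terms
  tie, but is continuous at interpolators because both gradients tend to \<open>0\<close> there.
\<close>

lemma f2G_subgradient_selection:
  fixes A1 :: "real^'d^'m1" and A2 :: "real^'d^'m2"
  assumes x: "x \<in> common_interpolators A1 A2 b1 b2"
  obtains G where "\<And>y. G y \<in> limiting_subdiff (f2G A1 A2 b1 b2) y" "isCont G x" "G x = 0"
proof -
  let ?f = "f2G A1 A2 b1 b2"
  define c1 c2 where "c1 = 1 / (2 * real CARD('m1))" and "c2 = 1 / (2 * real CARD('m2))"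
  have c: "c1 \<ge> 0" "c2 \<ge> 0" by (simp_all add: c1_def c2_def)
  define q1 q2 where "q1 y = c1 * (norm (A1 *v y - b1))\<^sup>2" and "q2 y = c2 * (norm (A2 *v y - b2))\<^sup>2" for y
  define g1 g2 where "g1 y = (2 * c1) *\<^sub>R (transpose A1 *v (A1 *v y - b1))"
    and "g2 y = (2 * c2) *\<^sub>R (transpose A2 *v (A2 *v y - b2))" for y
  have f: "?f y = max (q1 y) (q2 y)" for y
    by (simp add: f2G_def q1_def q2_def c1_def c2_def)
  have minorant: "q1 z \<ge> q1 y + g1 y \<bullet> (z - y)" "q2 z \<ge> q2 y + g2 y \<bullet> (z - y)" for y z
    unfolding q1_def q2_def g1_def g2_def using squared_residual_affine_minorant c by blast+
  define G where "G y = (if q1 y \<ge> q2 y then g1 y else g2 y)" for y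
  have "G y \<in> limiting_subdiff ?f y" for y
  proof (rule limiting_subdiffI_affine_minorant)
    fix z
    show "?f z \<ge> ?f y + G y \<bullet> (z - y)"
      using minorant[of y z] by (auto simp: f G_def max_def)
  qed
  moreover have zero: "g1 x = 0" "g2 x = 0"
    using x by (auto simp: common_interpolators_def g1_def g2_def)
  then have "G x = 0" by (simp add: G_def)
  moreover have "isCont G x"
  proof -
    have "isCont g1 x" "isCont g2 x"
      unfolding g1_def g2_def
      by (intro continuous_intros linear_continuous_at linear_linear[THEN iffD1]
          bounded_linear.isCont[OF matrix_vector_mul_bounded_linear])+
    then have "(g1 \<longlongrightarrow> 0) (at x)" "(g2 \<longlongrightarrow> 0) (at x)"
      using zero by (metis isCont_def)+
    then have "(G \<longlongrightarrow> 0) (at x)"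
      unfolding G_def by (intro filterlim_If tendsto_mono[OF inf_le1])
    then show ?thesis using \<open>G x = 0\<close> by (simp add: isCont_def)
  qed
  ultimately show ?thesis using that by blast
qed

text \<open>
  The function touches both \<open>\<epsilon>\<^sup>2\<close> and \<open>(\<epsilon> + t)\<^sup>2\<close> from above at \<open>t = 0\<close>. A derivative there
  would have to agree with the derivatives \<open>0\<close> and \<open>2 * \<epsilon>\<close> of both.
\<close>

lemma max_squares_not_differentiable:
  fixes \<epsilon> :: real
  assumes "\<epsilon> > 0"
  shows "\<not> (\<lambda>t. max ((\<epsilon> + t)\<^sup>2) (\<epsilon>\<^sup>2)) differentiable (at 0)" (is "\<not> ?\<phi> differentiable _")
proof
  assume "?\<phi> differentiable (at 0)"
  then obtain D where D: "(?\<phi> has_real_derivative D) (at 0)"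
    by (auto simp: real_differentiable_def)
  have "D = 0"
    by (rule DERIV_local_min[OF D, of 1]) auto
  have "((\<lambda>t. ?\<phi> t - (\<epsilon> + t)\<^sup>2) has_real_derivative D - 2 * \<epsilon>) (at 0)"
    by (rule DERIV_cong, rule DERIV_diff[OF D]) (auto intro!: derivative_eq_intros)
  then have "D - 2 * \<epsilon> = 0"
    by (rule DERIV_local_min[where d=1]) auto
  with \<open>D = 0\<close> assms show False by simp
qed

text \<open>
  In suitable directions \<open>a1\<close> and \<open>a2\<close> the function reads \<open>max (s\<^sup>2) (t\<^sup>2)\<close> around \<open>x\<close>. The
  kinks at \<open>s = t = \<epsilon>\<close> approach \<open>x\<close> as \<open>\<epsilon>\<close> tends to \<open>0\<close>.
\<close>

lemma f2G_not_differentiable_near_interpolator: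
  fixes A1 :: "real^'d^'m1" and A2 :: "real^'d^'m2"
  assumes surj: "\<forall>b1 b2. \<exists>x. A1 *v x = b1 \<and> A2 *v x = b2"
    and x: "x \<in> common_interpolators A1 A2 b1 b2"
  shows "\<not> (\<forall>\<^sub>F y in nhds x. f2G A1 A2 b1 b2 differentiable (at y))"
proof
  let ?f = "f2G A1 A2 b1 b2"
  assume ev: "\<forall>\<^sub>F y in nhds x. ?f differentiable (at y)"
  \<comment> \<open>these lengths cancel the factors \<open>1 / (2 * m)\<close> in \<open>f2G\<close>\<close>
  obtain u1 :: "real^'m1" where u1: "norm u1 = sqrt (2 * real CARD('m1))"
    using vector_choose_size[of "sqrt (2 * real CARD('m1))"] by auto
  obtain u2 :: "real^'m2" where u2: "norm u2 = sqrt (2 * real CARD('m2))"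
    using vector_choose_size[of "sqrt (2 * real CARD('m2))"] by auto
  obtain a1 a2 where a1: "A1 *v a1 = u1" "A2 *v a1 = 0" and a2: "A1 *v a2 = 0" "A2 *v a2 = u2"
    using surj by meson
  have f: "?f (x + (s *\<^sub>R a1 + t *\<^sub>R a2)) = max (s\<^sup>2) (t\<^sup>2)" for s t
    using x a1 a2
    by (simp add: f2G_def common_interpolators_def matrix_vector_right_distrib
        scaleR_matrix_vector_assoc[symmetric] matrix_vector_mult_scaleR u1 u2 power_mult_distrib)
  have "((\<lambda>\<epsilon>. x + (\<epsilon> *\<^sub>R a1 + \<epsilon> *\<^sub>R a2)) \<longlongrightarrow> x + (0 *\<^sub>R a1 + 0 *\<^sub>R a2)) (at_right 0)"
    by (intro tendsto_intros)
  then have "filterlim (\<lambda>\<epsilon>. x + (\<epsilon> *\<^sub>R a1 + \<epsilon> *\<^sub>R a2)) (nhds x) (at_right 0)" by simp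
  then have "\<forall>\<^sub>F \<epsilon> in at_right (0::real). ?f differentiable (at (x + (\<epsilon> *\<^sub>R a1 + \<epsilon> *\<^sub>R a2)))"
    using ev by (rule eventually_compose_filterlim[rotated])
  moreover have "\<forall>\<^sub>F \<epsilon> in at_right (0::real). \<epsilon> > 0"
    by (rule eventually_at_right_less)
  ultimately have "\<forall>\<^sub>F \<epsilon> in at_right (0::real).
      \<epsilon> > 0 \<and> ?f differentiable (at (x + (\<epsilon> *\<^sub>R a1 + \<epsilon> *\<^sub>R a2)))"
    by eventually_elim auto
  then obtain \<epsilon> :: real where eps: "\<epsilon> > 0" "?f differentiable (at (x + (\<epsilon> *\<^sub>R a1 + \<epsilon> *\<^sub>R a2)))"
    using eventually_happens'[OF trivial_limit_at_right_real] by blast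
  have "(\<lambda>t. ?f (x + ((\<epsilon> + t) *\<^sub>R a1 + \<epsilon> *\<^sub>R a2))) differentiable (at 0)"
  proof (rule differentiable_compose[of ?f])
    show "?f differentiable (at (x + ((\<epsilon> + 0) *\<^sub>R a1 + \<epsilon> *\<^sub>R a2)))" using eps by simp
    show "(\<lambda>t. x + ((\<epsilon> + t) *\<^sub>R a1 + \<epsilon> *\<^sub>R a2)) differentiable (at 0)"
      by (auto intro!: derivative_intros)
  qed
  then show False
    unfolding f using max_squares_not_differentiable[OF eps(1)] by blast
qed

lemma f2G_inactive_at_interpolator:
  fixes A1 :: "real^'d^'m1" and A2 :: "real^'d^'m2"
  assumes "\<forall>b1 b2. \<exists>x. A1 *v x = b1 \<and> A2 *v x = b2"
    and x: "x \<in> common_interpolators A1 A2 b1 b2"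
  shows "inactive (f2G A1 A2 b1 b2) x"
proof -
  obtain G where G: "\<And>y. G y \<in> limiting_subdiff (f2G A1 A2 b1 b2) y" "isCont G x" "G x = 0"
    using f2G_subgradient_selection[OF x] by blast
  have "\<not> C2_identifiable_manifold (f2G A1 A2 b1 b2) x 0 S" for S
  proof
    assume S: "C2_identifiable_manifold (f2G A1 A2 b1 b2) x 0 S"
    then have "identifiable (f2G A1 A2 b1 b2) x 0 S"
      unfolding C2_identifiable_manifold_def by blast
    from identifiable_contains_neighbourhood[OF this G] have "x \<in> interior S" .
    from C2_identifiable_manifold_interior_differentiable[OF S this]
    show False using f2G_not_differentiable_near_interpolator[OF assms] by blast
  qed
  then show ?thesis
    unfolding inactive_def using G(1)[of x] G(3) by auto
qed

lemma f2G_minimal_at_interpolator: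
  fixes A1 :: "real^'d^'m1" and A2 :: "real^'d^'m2"
  assumes "x \<in> common_interpolators A1 A2 b1 b2"
  shows "f2G A1 A2 b1 b2 x \<le> f2G A1 A2 b1 b2 y"
proof -
  have "f2G A1 A2 b1 b2 x = 0"
    using assms by (simp add: f2G_def common_interpolators_def)
  also have "\<dots> \<le> f2G A1 A2 b1 b2 y"
    unfolding f2G_def by (intro max.coboundedI1) simp
  finally show ?thesis .
qed

theorem corollary4p2:
  fixes M :: "'w measure"
    and A1 :: "'w \<Rightarrow> real^'d::finite^'m1::finite"
    and A2 :: "'w \<Rightarrow> real^'d::finite^'m2::finite"
  assumes "prob_space M"
    and "CARD('m1) + CARD('m2) \<le> CARD('d)"
    and "prob_space.indep_vars M (\<lambda>_. borel)
           (\<lambda>e \<omega>. case e of Inl (i, j) \<Rightarrow> A1 \<omega> $ i $ j | Inr (i, j) \<Rightarrow> A2 \<omega> $ i $ j)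
           (UNIV :: ('m1 \<times> 'd + 'm2 \<times> 'd) set)"
    and "\<And>i j. distributed M lborel (\<lambda>\<omega>. A1 \<omega> $ i $ j) std_normal_density"
    and "\<And>i j. distributed M lborel (\<lambda>\<omega>. A2 \<omega> $ i $ j) std_normal_density"
  shows "AE \<omega> in M. \<forall>b1 b2.
     (let S = common_interpolators (A1 \<omega>) (A2 \<omega>) b1 b2; f = f2G (A1 \<omega>) (A2 \<omega>) b1 b2 in
        S \<noteq> {} \<and> affine S \<and>
        aff_dim S = int CARD('d) - int CARD('m1) - int CARD('m2) \<and>
        (\<forall>x\<in>S. (\<forall>y. f x \<le> f y) \<and> inactive f x))"
  using AE_stacked_surjective[OF assms]
proof eventually_elim
  case (elim \<omega>)
  show ?case
    unfolding Let_def
    using common_interpolators_affine[OF elim] f2G_minimal_at_interpolator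
      f2G_inactive_at_interpolator[OF elim] by blast
qed

end
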